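(* Let $\mathcal K$ be the class of all finite cubic (3-regular) planar graphs, quasi-ordered by $G\le_{\mathcal K}H$ if and only if there exists a homomorphism $G\to H$. Then $(\mathcal K,\le_{\mathcal K})$ contains a universal partial order: there is a subset of $\mathcal K$ on which $\le_{\mathcal K}$ is a partial order into which every countable partial order embeds.
   Context: A graph homomorphism $G\to H$ is a map of vertices sending edges to edges. *)

theory Defs
  imports "HOL-Analysis.Analysis"
begin

datatype 'a graph = Graph (verts: "'a set") (edges: "'a set set")

definition finite_simple_graph :: "'a graph \<Rightarrow> bool" where
  "finite_simple_graph G \<longleftrightarrow>
     finite (verts G) \<and> verts G \<noteq> {} \<and> (\<forall>e\<in>edges G. e \<subseteq> verts G \<and> card e = 2)"

definition degree :: "'a graph \<Rightarrow> 'a \<Rightarrow> nat" where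
  "degree G v = card {e \<in> edges G. v \<in> e}"

definition cubic :: "'a graph \<Rightarrow> bool" where
  "cubic G \<longleftrightarrow> (\<forall>v\<in>verts G. degree G v = 3)"

text \<open>A drawing places the vertices at distinct points of the plane and draws every edge as a
  simple arc between its two end vertices. An arc passes through no further vertex, and two
  distinct arcs meet at most in the common end vertices of the two edges.\<close>

definition plane_drawing ::
  "'a graph \<Rightarrow> ('a \<Rightarrow> real^2) \<Rightarrow> ('a set \<Rightarrow> real \<Rightarrow> real^2) \<Rightarrow> bool" where
  "plane_drawing G p \<gamma> \<longleftrightarrow>
     inj_on p (verts G) \<and>
     (\<forall>e\<in>edges G. arc (\<gamma> e) \<and> {pathstart (\<gamma> e), pathfinish (\<gamma> e)} = p ` e \<and>
        path_image (\<gamma> e) \<inter> p ` verts G = p ` e) \<and>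
     (\<forall>e\<in>edges G. \<forall>e'\<in>edges G. e \<noteq> e' \<longrightarrow>
        path_image (\<gamma> e) \<inter> path_image (\<gamma> e') \<subseteq> p ` (e \<inter> e'))"

definition planar :: "'a graph \<Rightarrow> bool" where
  "planar G \<longleftrightarrow> (\<exists>p \<gamma>. plane_drawing G p \<gamma>)"

definition graph_hom :: "('a \<Rightarrow> 'b) \<Rightarrow> 'a graph \<Rightarrow> 'b graph \<Rightarrow> bool" where
  "graph_hom f G H \<longleftrightarrow> f ` verts G \<subseteq> verts H \<and> (\<forall>e\<in>edges G. f ` e \<in> edges H)"

definition hom_le :: "'a graph \<Rightarrow> 'b graph \<Rightarrow> bool"  (infix "\<le>\<^sub>h" 50) where
  "G \<le>\<^sub>h H \<longleftrightarrow> (\<exists>f. graph_hom f G H)"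

text \<open>Every finite graph is isomorphic to one whose vertices are natural numbers, so these
  represent the class of all finite graphs.\<close>

definition cubic_planar_graphs :: "nat graph set" where
  "cubic_planar_graphs = {G. finite_simple_graph G \<and> cubic G \<and> planar G}"

definition hom_order :: "nat graph set \<Rightarrow> nat graph rel" where
  "hom_order S = {(G, H). G \<in> S \<and> H \<in> S \<and> G \<le>\<^sub>h H}"

lemma preorder_on_hom_order: "preorder_on S (hom_order S)"
proof -
  have refl: "G \<le>\<^sub>h G" for G :: "nat graph"
    unfolding hom_le_def graph_hom_def by (rule exI[of _ "\<lambda>x. x"]) simp
  have trans: "G \<le>\<^sub>h K" if "G \<le>\<^sub>h H" "H \<le>\<^sub>h K" for G H K :: "nat graph"
  proof -
    from that obtain f g where "graph_hom f G H" "graph_hom g H K"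
      unfolding hom_le_def by blast
    then have "graph_hom (g \<circ> f) G K"
      unfolding graph_hom_def by (metis image_comp image_mono subset_trans)
    then show ?thesis unfolding hom_le_def by blast
  qed
  show ?thesis
    unfolding preorder_on_def refl_on_def trans_def hom_order_def
    using refl trans by blast
qed

definition order_embedding :: "('a \<Rightarrow> 'b) \<Rightarrow> 'a set \<Rightarrow> 'a rel \<Rightarrow> 'b set \<Rightarrow> 'b rel \<Rightarrow> bool" where
  "order_embedding f A r B s \<longleftrightarrow>
     f ` A \<subseteq> B \<and> inj_on f A \<and> (\<forall>x\<in>A. \<forall>y\<in>A. (x, y) \<in> r \<longleftrightarrow> (f x, f y) \<in> s)"

text \<open>Countable partial orders are represented by those on subsets of the natural numbers;
  \<open>universal_embeds_countable\<close> shows that this covers countable carriers of every type.\<close>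

definition universal_partial_order :: "'b set \<Rightarrow> 'b rel \<Rightarrow> bool" where
  "universal_partial_order B s \<longleftrightarrow> partial_order_on B s \<and>
     (\<forall>(A :: nat set) r. partial_order_on A r \<longrightarrow> (\<exists>f. order_embedding f A r B s))"

lemma universal_embeds_countable:
  assumes univ: "universal_partial_order B s"
    and po: "partial_order_on (A :: 'a set) r" and "countable A"
  shows "\<exists>f. order_embedding f A r B s"
proof -
  obtain g :: "'a \<Rightarrow> nat" where g: "inj_on g A"
    using \<open>countable A\<close> unfolding countable_def by blast
  define r' where "r' = map_prod g g ` r"
  have rA: "r \<subseteq> A \<times> A" and re: "refl_on A r" and tr: "trans r" and an: "antisym r"
    using po unfolding partial_order_on_def preorder_on_def by auto
  have iff: "(g x, g y) \<in> r' \<longleftrightarrow> (x, y) \<in> r" if "x \<in> A" "y \<in> A" for x y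
  proof
    assume "(g x, g y) \<in> r'"
    then obtain u v where uv: "(u, v) \<in> r" and eq: "g x = g u" "g y = g v"
      unfolding r'_def by blast
    have "u \<in> A" "v \<in> A" using uv rA by blast+
    then have "x = u" "y = v" using eq that g by (blast dest: inj_onD)+
    then show "(x, y) \<in> r" using uv by simp
  next
    assume "(x, y) \<in> r"
    then show "(g x, g y) \<in> r'" unfolding r'_def by force
  qed
  have sub: "r' \<subseteq> g ` A \<times> g ` A"
    using rA unfolding r'_def by auto
  have "refl_on (g ` A) r'"
    using re iff unfolding refl_on_def by blast
  moreover have "trans r'"
  proof (rule transI)
    fix a b c assume ab: "(a, b) \<in> r'" and bc: "(b, c) \<in> r'"
    then obtain x y z where "x \<in> A" "y \<in> A" "z \<in> A" "a = g x" "b = g y" "c = g z"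
      using sub by blast
    then show "(a, c) \<in> r'" using ab bc iff tr by (metis transD)
  qed
  moreover have "antisym r'"
  proof (rule antisymI)
    fix a b assume ab: "(a, b) \<in> r'" and ba: "(b, a) \<in> r'"
    then obtain x y where "x \<in> A" "y \<in> A" "a = g x" "b = g y"
      using sub by blast
    then show "a = b" using ab ba iff an by (metis antisymD)
  qed
  ultimately have "partial_order_on (g ` A) r'"
    using sub unfolding partial_order_on_def preorder_on_def by blast
  then obtain f where f: "order_embedding f (g ` A) r' B s"
    using univ unfolding universal_partial_order_def by blast
  have "order_embedding (f \<circ> g) A r B s"
    using f g iff unfolding order_embedding_def by (simp add: comp_inj_on image_comp)
  then show ?thesis by blast
qed

end

theory Submission
  imports Defs
begin

text \<open>There is a planar graph with twelve vertices, all cubic except for two ends of degree two, whose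
  endomorphisms permute the ends. Linking \<open>a\<close> copies of this gadget in a ring gives a cubic planar graph. Every
  gadget is connected by its pentagons, whereas no link lies in a closed walk of length five, so a
  homomorphism maps copies of the gadget to copies, ends to ends, and hence winds the ring of length
  \<open>a\<close> around that of length \<open>b\<close>; this requires \<open>b dvd a\<close>. Consequently, for disjoint unions of
  rings with lengths in \<open>A\<close> and \<open>B\<close>, there is a homomorphism iff every element of \<open>A\<close> has a
  divisor in \<open>B\<close>. Every countable partial order embeds into this quasi-order on finite sets.\<close>

section \<open>Planarity from book embeddings\<close>

text \<open>The first coordinate moves linearly along the diameter, so it alone gives injectivity.
  The height is the geometric mean of the two parts into which the diameter is cut.\<close>

definition semicircle :: "bool \<Rightarrow> real \<Rightarrow> real \<Rightarrow> real \<Rightarrow> real^2" where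
  "semicircle up l r t =
     vector [l + t * (r - l), (if up then 1 else - 1) * (r - l) * sqrt (t * (1 - t))]"

lemma pathstart_semicircle: "pathstart (semicircle up l r) = vector [l, 0]"
  and pathfinish_semicircle: "pathfinish (semicircle up l r) = vector [r, 0]"
  by (simp_all add: semicircle_def pathstart_def pathfinish_def)

lemma arc_semicircle:
  assumes "l < r"
  shows "arc (semicircle up l r)"
  unfolding arc_def
proof
  have "continuous_on {0..1} (\<lambda>t. semicircle up l r t $ i)" for i
  proof (cases "i = 1")
    case True
    then show ?thesis by (simp add: semicircle_def) (intro continuous_intros)
  next
    case False
    then have "i = 2" using exhaust_2 by blast
    then show ?thesis by (cases up) (auto simp: semicircle_def intro!: continuous_intros)
  qed
  then have "continuous_on {0..1} (\<lambda>t. \<chi> i. semicircle up l r t $ i)"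
    by (rule continuous_on_vec_lambda)
  then show "path (semicircle up l r)" by (simp add: path_def vec_lambda_eta)
  show "inj_on (semicircle up l r) {0..1}"
  proof (rule inj_onI)
    fix s t assume "semicircle up l r s = semicircle up l r t"
    then have "semicircle up l r s $ 1 = semicircle up l r t $ 1" by simp
    then show "s = t" using assms by (simp add: semicircle_def)
  qed
qed

text \<open>The altitude theorem replaces the parameter by the abscissa, so that two arcs can be
  compared above a common point of the axis.\<close>

lemma path_image_semicircle:
  assumes "l < r" "z \<in> path_image (semicircle up l r)"
  shows "l \<le> z $ 1" "z $ 1 \<le> r"
    and "z $ 2 = (if up then 1 else - 1) * sqrt ((z $ 1 - l) * (r - z $ 1))"
proof -
  obtain t where t: "0 \<le> t" "t \<le> 1" "z = semicircle up l r t"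
    using assms(2) unfolding path_image_def by auto
  have z1: "z $ 1 = l + t * (r - l)" using t by (simp add: semicircle_def)
  then show "l \<le> z $ 1" using t assms by simp
  have "t * (r - l) \<le> 1 * (r - l)" using t assms by (intro mult_right_mono) auto
  then show "z $ 1 \<le> r" using z1 by simp
  have "(z $ 1 - l) * (r - z $ 1) = (r - l)\<^sup>2 * (t * (1 - t))"
    by (simp add: z1 power2_eq_square algebra_simps)
  then have "sqrt ((z $ 1 - l) * (r - z $ 1)) = (r - l) * sqrt (t * (1 - t))"
    using assms by (simp add: real_sqrt_mult)
  then show "z $ 2 = (if up then 1 else - 1) * sqrt ((z $ 1 - l) * (r - z $ 1))"
    using t by (simp add: semicircle_def)
qed

lemma path_image_semicircle_axis:
  assumes "l < r" "z \<in> path_image (semicircle up l r)" "z $ 2 = 0"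
  shows "z $ 1 = l \<or> z $ 1 = r"
  using path_image_semicircle[OF assms(1,2)] assms(3) by (auto split: if_splits)

text \<open>At a common point off the axis, the sign of the second coordinate shows that the pages
  agree. Both diameters contain its abscissa in their interior, so without crossing they are nested;
  but then the outer semicircle is strictly higher there.\<close>

lemma semicircles_meet_at_ends:
  assumes "l < r" "l' < r'" "(l, r) \<noteq> (l', r')"
    and "up = up' \<Longrightarrow> \<not> (l < l' \<and> l' < r \<and> r < r')"
    and "up = up' \<Longrightarrow> \<not> (l' < l \<and> l < r' \<and> r' < r)"
    and z: "z \<in> path_image (semicircle up l r)" "z \<in> path_image (semicircle up' l' r')"
  shows "z $ 2 = 0"
proof (rule ccontr)
  assume nz: "z $ 2 \<noteq> 0"
  note Z = path_image_semicircle[OF assms(1) z(1)] and Z' = path_image_semicircle[OF assms(2) z(2)]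
  let ?x = "z $ 1"
  have pos: "0 < (?x - l) * (r - ?x)" "0 < (?x - l') * (r' - ?x)"
    using nz Z Z' by (auto simp: less_le)
  have "0 < z $ 2 \<longleftrightarrow> up" using pos(1) unfolding Z(3) by (cases up) (simp_all add: not_less)
  moreover have "0 < z $ 2 \<longleftrightarrow> up'" using pos(2) unfolding Z'(3) by (cases up') (simp_all add: not_less)
  ultimately have "up = up'" by blast
  then have eq: "(?x - l) * (r - ?x) = (?x - l') * (r' - ?x)"
    using Z(3) Z'(3) by (auto split: if_splits)
  have lt: "l < ?x" "?x < r" "l' < ?x" "?x < r'"
    using Z Z' nz by (auto simp: less_le)
  have nested: False if "a \<le> c" "d \<le> b" "(a, b) \<noteq> (c, d)" "c < ?x" "?x < d"
    "(?x - a) * (b - ?x) = (?x - c) * (d - ?x)" for a b c d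
  proof (cases "a = c")
    case True
    then show ?thesis using that by auto
  next
    case False
    then have "(?x - c) * (d - ?x) < (?x - a) * (d - ?x)" using that by (intro mult_strict_right_mono) auto
    also have "\<dots> \<le> (?x - a) * (b - ?x)" using that by (intro mult_left_mono) auto
    finally show ?thesis using that by simp
  qed
  have "l \<le> l' \<and> r' \<le> r \<or> l' \<le> l \<and> r \<le> r'"
    using assms(4,5) \<open>up = up'\<close> lt by linarith
  then show False
    using nested[of l l' r' r] nested[of l' l r r'] lt eq assms(3) by auto
qed

text \<open>Vertices are put on the axis, and each edge becomes a semicircle, above the axis if
  \<open>page\<close> holds and below it otherwise. As the ends of an edge and the two edges may be
  renamed, one interleaving pattern covers all crossings.\<close>

lemma planar_two_page:
  fixes pos :: "'a \<Rightarrow> real" and page :: "'a set \<Rightarrow> bool"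
  assumes inj: "inj_on pos (verts G)"
    and simple: "\<And>e. e \<in> edges G \<Longrightarrow> e \<subseteq> verts G \<and> card e = 2"
    and noncrossing: "\<And>a b c d. {a, b} \<in> edges G \<Longrightarrow> {c, d} \<in> edges G \<Longrightarrow>
      page {a, b} = page {c, d} \<Longrightarrow> pos a < pos c \<Longrightarrow> pos c < pos b \<Longrightarrow> pos b < pos d \<Longrightarrow> False"
  shows "planar G"
proof -
  define p :: "'a \<Rightarrow> real^2" where "p v = vector [pos v, 0]" for v
  define \<gamma> where "\<gamma> e = semicircle (page e) (Min (pos ` e)) (Max (pos ` e))" for e
  have p12: "p v $ 1 = pos v" "p v $ 2 = 0" for v by (simp_all add: p_def)
  have p_eqI: "z = p v" if "z $ 1 = pos v" "z $ 2 = 0" for z v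
    using that by (simp add: p_def vec_eq_iff forall_2)
  have edge: "\<exists>v w. e = {v, w} \<and> v \<in> verts G \<and> w \<in> verts G \<and> pos v < pos w \<and>
      \<gamma> e = semicircle (page e) (pos v) (pos w)" if e: "e \<in> edges G" for e
  proof -
    obtain v w where vw: "e = {v, w}" "v \<noteq> w" using simple[OF e] by (meson card_2_iff)
    then have V: "v \<in> verts G" "w \<in> verts G" using simple[OF e] by auto
    then have "pos v \<noteq> pos w" using inj vw by (auto dest: inj_onD)
    then consider "pos v < pos w" | "pos w < pos v" by linarith
    then show ?thesis
    proof cases
      case 1
      then show ?thesis using vw V by (intro exI[of _ v] exI[of _ w]) (simp add: \<gamma>_def)
    next
      case 2
      then show ?thesis using vw V by (intro exI[of _ w] exI[of _ v]) (auto simp: \<gamma>_def)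
    qed
  qed
  have "plane_drawing G p \<gamma>"
    unfolding plane_drawing_def
  proof (intro conjI ballI impI)
    show "inj_on p (verts G)"
      using inj p12 by (metis inj_on_def)
  next
    fix e assume e: "e \<in> edges G"
    then obtain v w where vw: "e = {v, w}" "v \<in> verts G" "w \<in> verts G" "pos v < pos w"
      "\<gamma> e = semicircle (page e) (pos v) (pos w)"
      using edge by blast
    show "arc (\<gamma> e)" using vw arc_semicircle by simp
    show ends: "{pathstart (\<gamma> e), pathfinish (\<gamma> e)} = p ` e"
      unfolding vw(5) pathstart_semicircle pathfinish_semicircle using vw(1) by (auto simp: p_def)
    have "p ` e \<subseteq> path_image (\<gamma> e)" using ends by (metis pathstart_in_path_image pathfinish_in_path_image insert_subset empty_subsetI)
    moreover have "p u \<in> p ` e" if "u \<in> verts G" "p u \<in> path_image (\<gamma> e)" for u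
    proof -
      have "pos u = pos v \<or> pos u = pos w"
        using path_image_semicircle_axis[OF vw(4), of "p u"] that vw(5) p12 by metis
      then show ?thesis using p_eqI p12 vw(1) by (metis image_eqI insertCI)
    qed
    ultimately show "path_image (\<gamma> e) \<inter> p ` verts G = p ` e" using vw by blast
  next
    fix e e' assume e: "e \<in> edges G" and e': "e' \<in> edges G" and "e \<noteq> e'"
    obtain v w where vw: "e = {v, w}" "v \<in> verts G" "w \<in> verts G" "pos v < pos w"
      "\<gamma> e = semicircle (page e) (pos v) (pos w)"
      using edge[OF e] by blast
    obtain v' w' where vw': "e' = {v', w'}" "v' \<in> verts G" "w' \<in> verts G" "pos v' < pos w'"
      "\<gamma> e' = semicircle (page e') (pos v') (pos w')"
      using edge[OF e'] by blast
    have ne: "(pos v, pos w) \<noteq> (pos v', pos w')"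
      using \<open>e \<noteq> e'\<close> inj vw vw' by (auto dest: inj_onD)
    show "path_image (\<gamma> e) \<inter> path_image (\<gamma> e') \<subseteq> p ` (e \<inter> e')"
    proof
      fix z assume z: "z \<in> path_image (\<gamma> e) \<inter> path_image (\<gamma> e')"
      have "z $ 2 = 0"
      proof (rule semicircles_meet_at_ends[OF vw(4) vw'(4) ne])
        show "\<not> (pos v < pos v' \<and> pos v' < pos w \<and> pos w < pos w')" if "page e = page e'"
          using noncrossing[of v w v' w'] e e' that vw(1) vw'(1) by blast
        show "\<not> (pos v' < pos v \<and> pos v < pos w' \<and> pos w' < pos w)" if "page e = page e'"
          using noncrossing[of v' w' v w] e e' that vw(1) vw'(1) by metis
      qed (use z vw(5) vw'(5) in auto)
      \<comment> \<open>A semicircle has only its ends on the axis, so the common point is an end of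
        both edges, and \<open>pos\<close> identifies the vertex.\<close>
      moreover from this have "z $ 1 \<in> pos ` e" "z $ 1 \<in> pos ` e'"
        using path_image_semicircle_axis[OF vw(4), of z] path_image_semicircle_axis[OF vw'(4), of z]
          z vw(1,5) vw'(1,5) by auto
      then obtain u u' where u: "u \<in> e" "z $ 1 = pos u" and u': "u' \<in> e'" "z $ 1 = pos u'" by auto
      moreover have "u = u'"
        using inj_onD[OF inj, of u u'] u u' simple[OF e] simple[OF e'] by auto
      ultimately show "z \<in> p ` (e \<inter> e')" using p_eqI by (metis IntI image_eqI)
    qed
  qed
  then show ?thesis unfolding planar_def by blast
qed

section \<open>Graphs of relations and injective images\<close>

text \<open>Meant for symmetric \<open>R\<close>: degrees then count related vertices, and
  homomorphisms can be checked on ordered pairs instead of two-element sets.\<close>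

definition rel_graph :: "'a set \<Rightarrow> ('a \<Rightarrow> 'a \<Rightarrow> bool) \<Rightarrow> 'a graph" where
  "rel_graph V R = Graph V {{p, q} |p q. p \<in> V \<and> q \<in> V \<and> R p q}"

lemma verts_rel_graph [simp]: "verts (rel_graph V R) = V"
  by (simp add: rel_graph_def)

lemma edge_rel_graph_iff:
  assumes "symp R"
  shows "{p, q} \<in> edges (rel_graph V R) \<longleftrightarrow> p \<in> V \<and> q \<in> V \<and> R p q"
  using sympD[OF assms] by (auto simp: rel_graph_def doubleton_eq_iff)

lemma finite_simple_rel_graph:
  assumes "finite V" "V \<noteq> {}" "irreflp R"
  shows "finite_simple_graph (rel_graph V R)"
  unfolding finite_simple_graph_def
proof (intro conjI ballI)
  fix e assume "e \<in> edges (rel_graph V R)"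
  then obtain p q where "e = {p, q}" "p \<in> V" "q \<in> V" "R p q"
    by (auto simp: rel_graph_def)
  moreover from this have "p \<noteq> q" using assms(3) by (auto dest: irreflpD)
  ultimately show "e \<subseteq> verts (rel_graph V R)" "card e = 2" by auto
qed (use assms in auto)

lemma degree_rel_graph:
  assumes "symp R" "v \<in> V"
  shows "degree (rel_graph V R) v = card {w \<in> V. R v w}"
proof -
  have "{e \<in> edges (rel_graph V R). v \<in> e} = (\<lambda>w. {v, w}) ` {w \<in> V. R v w}"
    using assms(2) sympD[OF assms(1)] by (auto simp: rel_graph_def)
  moreover have "inj_on (\<lambda>w. {v, w}) {w \<in> V. R v w}"
    by (auto simp: inj_on_def doubleton_eq_iff)
  ultimately show ?thesis by (simp add: degree_def card_image)
qed

lemma graph_hom_rel_graph: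
  assumes "symp S"
  shows "graph_hom f (rel_graph V R) (rel_graph W S) \<longleftrightarrow>
    f ` V \<subseteq> W \<and> (\<forall>p\<in>V. \<forall>q\<in>V. R p q \<longrightarrow> S (f p) (f q))"
proof -
  have "(\<forall>e\<in>edges (rel_graph V R). P e) \<longleftrightarrow> (\<forall>p\<in>V. \<forall>q\<in>V. R p q \<longrightarrow> P {p, q})" for P
    unfolding rel_graph_def graph.sel by blast
  then show ?thesis
    unfolding graph_hom_def by (auto simp: edge_rel_graph_iff[OF assms])
qed

lemma hom_le_refl: "G \<le>\<^sub>h G"
  unfolding hom_le_def graph_hom_def by (intro exI[of _ "\<lambda>x. x"]) simp

lemma hom_le_trans:
  assumes "G \<le>\<^sub>h H" "H \<le>\<^sub>h K"
  shows "G \<le>\<^sub>h K"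
proof -
  obtain f g where "graph_hom f G H" "graph_hom g H K"
    using assms unfolding hom_le_def by blast
  then have "graph_hom (g \<circ> f) G K"
    unfolding graph_hom_def by (metis image_comp image_mono subset_trans)
  then show ?thesis unfolding hom_le_def by blast
qed

text \<open>Along an injection this is a relabelling; it moves graphs on triples to graphs on
  natural numbers.\<close>

definition image_graph :: "('a \<Rightarrow> 'b) \<Rightarrow> 'a graph \<Rightarrow> 'b graph" where
  "image_graph f G = Graph (f ` verts G) ((`) f ` edges G)"

lemma edges_image_graph: "edges (image_graph f G) = (`) f ` edges G"
  and verts_image_graph: "verts (image_graph f G) = f ` verts G"
  by (simp_all add: image_graph_def)

lemma hom_le_image_graph: "G \<le>\<^sub>h image_graph f G"
  unfolding hom_le_def graph_hom_def
  by (intro exI[of _ f]) (simp add: edges_image_graph verts_image_graph)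

lemma image_graph_hom_le: "inj f \<Longrightarrow> image_graph f G \<le>\<^sub>h G"
  unfolding hom_le_def graph_hom_def
  by (intro exI[of _ "inv f"]) (simp add: edges_image_graph verts_image_graph image_inv_f_f)

lemma hom_le_image_graph_iff:
  assumes "inj f" "inj g"
  shows "image_graph f G \<le>\<^sub>h image_graph g H \<longleftrightarrow> G \<le>\<^sub>h H"
  using hom_le_image_graph image_graph_hom_le assms hom_le_trans by metis

lemma finite_simple_image_graph:
  assumes "inj f" "finite_simple_graph G"
  shows "finite_simple_graph (image_graph f G)"
  using assms card_image[OF inj_on_subset[OF assms(1) subset_UNIV]]
  unfolding finite_simple_graph_def edges_image_graph verts_image_graph by auto

lemma cubic_image_graph:
  assumes "inj f" "cubic G"
  shows "cubic (image_graph f G)"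
  unfolding cubic_def
proof
  fix w assume "w \<in> verts (image_graph f G)"
  then obtain v where v: "v \<in> verts G" "w = f v" by (auto simp: verts_image_graph)
  have "{e \<in> edges (image_graph f G). w \<in> e} = (`) f ` {e \<in> edges G. v \<in> e}"
    unfolding edges_image_graph using v inj_image_mem_iff[OF assms(1)] by auto
  moreover have "inj_on ((`) f) {e \<in> edges G. v \<in> e}"
    using assms(1) inj_on_image inj_on_subset by blast
  ultimately have "degree (image_graph f G) w = degree G v"
    by (simp add: degree_def card_image)
  then show "degree (image_graph f G) w = 3" using assms(2) v by (simp add: cubic_def)
qed

lemma planar_image_graph:
  assumes "inj f" "planar G"
  shows "planar (image_graph f G)"
proof -
  obtain p \<gamma> where d: "plane_drawing G p \<gamma>" using assms(2) unfolding planar_def by blast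
  have inv: "inv f ` f ` X = X" "(\<lambda>v. p (inv f v)) ` f ` X = p ` X"
    "f ` X \<inter> f ` Y = f ` (X \<inter> Y)" "f ` X = f ` Y \<longleftrightarrow> X = Y" for X Y
    using assms(1) by (simp_all add: image_image image_inv_f_f image_Int inj_image_eq_iff)
  have "inj_on (\<lambda>v. p (inv f v)) (f ` verts G)"
    using d inv_f_f[OF assms(1)] unfolding plane_drawing_def by (auto simp: inj_on_def)
  then have "plane_drawing (image_graph f G) (\<lambda>v. p (inv f v)) (\<lambda>e. \<gamma> (inv f ` e))"
    using d unfolding plane_drawing_def edges_image_graph verts_image_graph ball_simps
    by (simp add: inv)
  then show ?thesis unfolding planar_def by blast
qed

section \<open>The gadget\<close>

text \<open>A path \<open>0, \<dots>, 11\<close> with the chords 04, 69, 5-11 on one page of a book and 37, 28, 1-10 on the other.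
  The end vertices 0 and 11 have degree two; the graph was found by a computer search.\<close>

definition gadget_nbrs :: "nat list list" where
  "gadget_nbrs = [[1,4],[0,2,10],[1,3,8],[2,4,7],[3,5,0],[4,6,11],[5,7,9],[6,8,3],[7,9,2],[8,10,6],[9,11,1],[10,5]]"

text \<open>The explicit bound on \<open>x\<close> guards the list lookup; the bound on
  \<open>y\<close> then follows by symmetry.\<close>

definition gadget :: "nat \<Rightarrow> nat \<Rightarrow> bool" where
  "gadget x y \<longleftrightarrow> x < 12 \<and> y \<in> set (gadget_nbrs ! x)"

text \<open>A homomorphism from the subgraph on the first \<open>n\<close> vertices is the list of its values; vertex \<open>n\<close>
  is adjacent to \<open>n - 1\<close>, which leaves at most three values to try for it.\<close>

fun partial_homs :: "nat \<Rightarrow> nat list list" where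
  "partial_homs 0 = [[]]"
| "partial_homs (Suc n) =
     [g @ [y]. g \<leftarrow> partial_homs n,
               y \<leftarrow> (if n = 0 then [0..<12] else gadget_nbrs ! (g ! (n - 1))),
               list_all (\<lambda>x. x < n \<longrightarrow> y \<in> set (gadget_nbrs ! (g ! x))) (gadget_nbrs ! n)]"

text \<open>Exhaustive evaluation of the search for endomorphisms of the gadget: each fixes or swaps
  the two ends.\<close>

lemma partial_homs_12_ends: "\<forall>g \<in> set (partial_homs 12). g ! 0 = 0 \<and> g ! 11 = 11 \<or> g ! 0 = 11 \<and> g ! 11 = 0"
  by code_simp

lemma gadget_sym: "gadget x y \<Longrightarrow> gadget y x"
proof -
  have *: "\<forall>x\<in>set [0..<12]. \<forall>y\<in>set (gadget_nbrs ! x). y < 12 \<and> x \<in> set (gadget_nbrs ! y)" by code_simp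
  assume "gadget x y"
  then show "gadget y x" using *[THEN bspec, of x] unfolding gadget_def by (simp del: upt_rec_numeral)
qed

lemma gadget_lt: "gadget x y \<Longrightarrow> x < 12 \<and> y < 12"
  using gadget_sym unfolding gadget_def by blast

lemma gadget_irrefl: "\<not> gadget x x"
proof -
  have *: "\<forall>x\<in>set [0..<12]. x \<notin> set (gadget_nbrs ! x)" by code_simp
  then show ?thesis unfolding gadget_def by auto
qed

lemma partial_homs_SucI:
  assumes "g \<in> set (partial_homs n)"
    and "y \<in> set (if n = 0 then [0..<12] else gadget_nbrs ! (g ! (n - 1)))"
    and "list_all (\<lambda>x. x < n \<longrightarrow> y \<in> set (gadget_nbrs ! (g ! x))) (gadget_nbrs ! n)"
  shows "g @ [y] \<in> set (partial_homs (Suc n))"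
  unfolding partial_homs.simps set_concat set_map
  apply (rule UnionI, rule imageI, rule imageI, rule assms(1))
  unfolding set_concat set_map
  apply (rule UnionI, rule imageI, rule imageI, rule assms(2))
  by (simp add: assms(3))

text \<open>The search misses no endomorphism: the value at \<open>n\<close> is adjacent to the
  value at \<open>n - 1\<close> and to the values at all earlier neighbours, so every prefix passes
  the filters.\<close>

lemma mem_partial_homs:
  assumes "\<And>x y. gadget x y \<Longrightarrow> gadget (f x) (f y)" and "n \<le> 12"
  shows "map f [0..<n] \<in> set (partial_homs n)"
  using assms(2)
proof (induction n)
  case 0
  then show ?case by simp
next
  case (Suc n)
  \<comment> \<open>The range of \<open>f\<close> is not assumed bounded, but no gadget vertex is
    isolated, and \<open>gadget\<close> relates only numbers below 12.\<close>
  have lt: "f x < 12" if "x < 12" for x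
  proof -
    have "\<forall>x\<in>set [0..<12]. gadget_nbrs ! x \<noteq> []" by code_simp
    then have "gadget x (hd (gadget_nbrs ! x))" using that by (simp add: gadget_def)
    then show ?thesis using assms(1) gadget_def by blast
  qed
  have adj: "f y \<in> set (gadget_nbrs ! f x)" if "gadget x y" for x y
    using assms(1)[OF that] by (simp add: gadget_def)
  have *: "\<forall>n\<in>set [1..<12]. n \<in> set (gadget_nbrs ! (n-1))" by code_simp
  have 1: "gadget (n - 1) n" if "n \<noteq> 0" using Suc.prems that *
    by (simp add: gadget_def)
  have 2: "gadget x n" if "x \<in> set (gadget_nbrs ! n)" for x
    using Suc.prems that gadget_sym[of n x] by (simp add: gadget_def)
  have nn: "f n \<in> set (if n = 0 then [0..<12] else gadget_nbrs ! (map f [0..<n] ! (n - 1)))"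
  proof (cases "n = 0")
    case True
    then show ?thesis using lt[of n] by (simp del: upt_rec_numeral)
  next
    case False
    then show ?thesis using adj[OF 1] by simp
  qed
  have "list_all (\<lambda>x. x < n \<longrightarrow> f n \<in> set (gadget_nbrs ! (map f [0..<n] ! x))) (gadget_nbrs ! n)"
    using adj[OF 2] by (simp add: list_all_iff)
  moreover have "map f [0..<n] \<in> set (partial_homs n)" using Suc by simp
  ultimately show ?case using partial_homs_SucI nn by simp
qed

lemma gadget_rigid:
  assumes "\<And>x y. gadget x y \<Longrightarrow> gadget (f x) (f y)"
  shows "f 0 = 0 \<and> f 11 = 11 \<or> f 0 = 11 \<and> f 11 = 0"
proof -
  define g where "g = map f [0..<12]"
  have "g \<in> set (partial_homs 12)" unfolding g_def by (rule mem_partial_homs) (use assms in auto)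
  moreover have "g ! 0 = f 0" "g ! 11 = f 11"
    unfolding g_def by (subst nth_map; simp del: upt_rec_numeral)+
  ultimately show ?thesis using partial_homs_12_ends by metis
qed

section \<open>Rings of gadgets\<close>

text \<open>The directed successor relation on a cycle, with the wrap-around as an explicit case
  instead of \<open>mod\<close>. Length 1 would give a loop, hence the bound
  \<open>2 \<le> a\<close> later on.\<close>

definition cyc :: "nat \<Rightarrow> nat \<Rightarrow> nat \<Rightarrow> bool" where
  "cyc a i j \<longleftrightarrow> i < a \<and> j < a \<and> (j = Suc i \<or> Suc i = a \<and> j = 0)"

text \<open>Vertex \<open>(a, i, x)\<close> is vertex \<open>x\<close> of the \<open>i\<close>-th gadget on the ring of \<open>a\<close> gadgets.\<close>

definition necklace_adj :: "nat \<times> nat \<times> nat \<Rightarrow> nat \<times> nat \<times> nat \<Rightarrow> bool" where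
  "necklace_adj = (\<lambda>(a, i, x) (b, j, y). a = b \<and>
     (i = j \<and> gadget x y \<or> x = 11 \<and> y = 0 \<and> cyc a i j \<or> x = 0 \<and> y = 11 \<and> cyc a j i))"

definition necklace_verts :: "nat set \<Rightarrow> (nat \<times> nat \<times> nat) set" where
  "necklace_verts A = {(a, i, x). a \<in> A \<and> i < a \<and> x < 12}"

definition necklaces :: "nat set \<Rightarrow> (nat \<times> nat \<times> nat) graph" where
  "necklaces A = rel_graph (necklace_verts A) necklace_adj"

lemma symp_necklace_adj: "symp necklace_adj"
  by (auto simp: symp_def necklace_adj_def dest: gadget_sym)

lemma irreflp_necklace_adj: "irreflp necklace_adj"
  by (auto simp: irreflp_def necklace_adj_def gadget_irrefl)

lemma finite_simple_necklaces:
  assumes "finite A" "A \<noteq> {}" "\<And>a. a \<in> A \<Longrightarrow> 2 \<le> a"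
  shows "finite_simple_graph (necklaces A)"
  unfolding necklaces_def
proof (rule finite_simple_rel_graph[OF _ _ irreflp_necklace_adj])
  have "necklace_verts A \<subseteq> A \<times> (\<Union>a\<in>A. {..<a}) \<times> {..<12}"
    by (auto simp: necklace_verts_def)
  then show "finite (necklace_verts A)"
    by (rule finite_subset) (use assms(1) in auto)
  obtain a where "a \<in> A" using assms(2) by blast
  then have "(a, 0, 0) \<in> necklace_verts A" using assms(3)[of a] by (simp add: necklace_verts_def)
  then show "necklace_verts A \<noteq> {}" by blast
qed

lemma cubic_necklaces:
  assumes "\<And>a. a \<in> A \<Longrightarrow> 2 \<le> a"
  shows "cubic (necklaces A)"
  unfolding cubic_def necklaces_def verts_rel_graph
proof
  fix v assume v: "v \<in> necklace_verts A"
  then obtain a i x where ai: "v = (a, i, x)" "a \<in> A" "i < a" "x < 12"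
    by (auto simp: necklace_verts_def)
  \<comment> \<open>The neighbours across a link: one for either end of the gadget, none for inner
    vertices. By \<open>2 \<le> a\<close> a link leads to a different copy, so nothing is counted
    twice.\<close>
  define L :: "(nat \<times> nat \<times> nat) set" where "L = (if x = 0 then {(a, if i = 0 then a - 1 else i - 1, 11)}
    else if x = 11 then {(a, if Suc i = a then 0 else Suc i, 0)} else {})"
  have "2 \<le> a" using ai assms by blast
  have L: "card L = (if x = 0 \<or> x = 11 then 1 else 0)" "finite L"
    "L \<inter> (\<lambda>y. (a, i, y)) ` set (gadget_nbrs ! x) = {}"
    using \<open>2 \<le> a\<close> by (auto simp: L_def split: if_splits)
  have "{w \<in> necklace_verts A. necklace_adj v w} =
      L \<union> (\<lambda>y. (a, i, y)) ` set (gadget_nbrs ! x)" (is "?N = _ \<union> ?G")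
  proof -
    have lt: "y < 12" if "y \<in> set (gadget_nbrs ! x)" for y
      using gadget_lt[of x y] that ai(4) by (simp add: gadget_def)
    have "?G = {w \<in> necklace_verts A. \<exists>y. w = (a, i, y) \<and> gadget x y}"
      using ai lt by (auto simp: gadget_def necklace_verts_def)
    moreover have "L = {w \<in> necklace_verts A. \<exists>j. x = 11 \<and> w = (a, j, 0) \<and> cyc a i j \<or>
        x = 0 \<and> w = (a, j, 11) \<and> cyc a j i}"
      using ai \<open>2 \<le> a\<close> by (auto simp: L_def cyc_def necklace_verts_def)
    ultimately show ?thesis by (auto simp: ai(1) necklace_adj_def)
  qed
  moreover have "card ?G = (if x = 0 \<or> x = 11 then 2 else 3)"
  proof -
    have "\<forall>x\<in>set [0..<12]. card (set (gadget_nbrs ! x)) = (if x = 0 \<or> x = 11 then 2 else 3)"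
      by code_simp
    from this[THEN bspec, of x] show ?thesis
      using ai(4) by (simp add: card_image inj_on_def del: upt_rec_numeral)
  qed
  ultimately have "card {w \<in> necklace_verts A. necklace_adj v w} = 3"
    using L by (simp add: card_Un_disjoint split: if_splits)
  then show "degree (rel_graph (necklace_verts A) necklace_adj) v = 3"
    using degree_rel_graph[OF symp_necklace_adj v] by simp
qed

text \<open>Ring \<open>b\<close> occupies the block numbers from \<open>b\<^sup>2\<close> to below
  \<open>b\<^sup>2 + b\<close>, which is less than \<open>(Suc b)\<^sup>2\<close>.\<close>

lemma blocks_disjoint:
  fixes a b :: nat
  assumes "k < b" "a\<^sup>2 + i \<le> b\<^sup>2 + k"
  shows "a \<le> b"
proof (rule ccontr)
  assume "\<not> a \<le> b"
  then have "(Suc b)\<^sup>2 \<le> a\<^sup>2" by (intro power_mono) auto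
  then show False using assms by (simp add: power2_eq_square)
qed

text \<open>The spine of the book runs through the copies of the gadget one after the other;
  block number \<open>a\<^sup>2 + i\<close> keeps the rings apart because \<open>i < a\<close>.\<close>

definition spine :: "nat \<times> nat \<times> nat \<Rightarrow> nat" where
  "spine = (\<lambda>(a, i, x). 12 * (a\<^sup>2 + i) + x)"

text \<open>Each chord is listed from left to right. The three are nested; all other edges, links
  included, go on the other page.\<close>

definition lower_chords :: "(nat \<times> nat) list" where
  "lower_chords = [(3, 7), (2, 8), (1, 10)]"

definition lower_page :: "(nat \<times> nat \<times> nat) set \<Rightarrow> bool" where
  "lower_page e \<longleftrightarrow> (\<exists>a i x y. e = {(a, i, x), (a, i, y)} \<and> (x, y) \<in> set lower_chords)"

lemma base12_less: "12 * m + x < 12 * n + y \<Longrightarrow> x < 12 \<Longrightarrow> y < 12 \<Longrightarrow> m < n \<or> m = n \<and> x < y"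
  for m n x y :: nat
  by presburger

lemma base12_eq: "12 * m + x = 12 * n + y \<Longrightarrow> x < 12 \<Longrightarrow> y < 12 \<Longrightarrow> m = n \<and> x = y"
  for m n x y :: nat
  by presburger

text \<open>Positions are ordered lexicographically: base 12 separates the copy from the vertex, and
  the disjoint blocks separate the rings.\<close>

lemma spine_less:
  assumes "p \<in> necklace_verts A" "q \<in> necklace_verts A" "spine p < spine q"
  shows "fst p < fst q \<or> fst p = fst q \<and>
    (fst (snd p) < fst (snd q) \<or> fst (snd p) = fst (snd q) \<and> snd (snd p) < snd (snd q))"
proof -
  obtain a i x b j y where pq: "p = (a, i, x)" "q = (b, j, y)" by (metis prod_cases3)
  have b: "i < a" "x < 12" "j < b" "y < 12" and "12 * (a\<^sup>2 + i) + x < 12 * (b\<^sup>2 + j) + y"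
    using assms by (auto simp: pq necklace_verts_def spine_def)
  then have le: "a\<^sup>2 + i < b\<^sup>2 + j \<or> a\<^sup>2 + i = b\<^sup>2 + j \<and> x < y" by (intro base12_less)
  then have "a \<le> b" using blocks_disjoint[of j b a i] b by auto
  then show ?thesis using le by (cases "a = b") (auto simp: pq)
qed

lemma inj_on_spine: "inj_on spine (necklace_verts A)"
proof (rule inj_onI)
  fix p q assume pq: "p \<in> necklace_verts A" "q \<in> necklace_verts A" "spine p = spine q"
  obtain a i x b j y where e: "p = (a, i, x)" "q = (b, j, y)" by (metis prod_cases3)
  have b: "i < a" "x < 12" "j < b" "y < 12" and "12 * (a\<^sup>2 + i) + x = 12 * (b\<^sup>2 + j) + y"
    using pq by (auto simp: e necklace_verts_def spine_def)
  then have eq: "a\<^sup>2 + i = b\<^sup>2 + j" "x = y" using base12_eq by blast+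
  then have "a = b"
    using blocks_disjoint[of j b a i] blocks_disjoint[of i a b j] b by auto
  then show "p = q" using eq by (simp add: e)
qed

lemma gadget_noncrossing:
  assumes "gadget x y" "gadget z w" "x < z" "z < y" "y < w"
  shows "((x, y) \<in> set lower_chords) \<noteq> ((z, w) \<in> set lower_chords)"
proof -
  have *: "\<forall>x\<in>set [0..<12]. \<forall>y\<in>set (gadget_nbrs ! x). \<forall>z\<in>set [0..<12]. \<forall>w\<in>set (gadget_nbrs ! z).
      x < z \<longrightarrow> z < y \<longrightarrow> y < w \<longrightarrow> ((x, y) \<in> set lower_chords) \<noteq> ((z, w) \<in> set lower_chords)"
    by code_simp
  have "x \<in> set [0..<12]" "z \<in> set [0..<12]" "y \<in> set (gadget_nbrs ! x)" "w \<in> set (gadget_nbrs ! z)"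
    using assms by (simp_all add: gadget_def del: upt_rec_numeral)
  then show ?thesis using * assms(3-5) by blast
qed

lemma lower_page_inner:
  assumes "x < y"
  shows "lower_page {(a, i, x), (a, i, y)} \<longleftrightarrow> (x, y) \<in> set lower_chords"
  using assms by (auto simp: lower_page_def lower_chords_def doubleton_eq_iff)

text \<open>Rings occupy disjoint intervals of the spine, so interleaving edges share a ring. A link
  between successive copies joins neighbouring positions and a closing link spans its whole ring, so
  neither can interleave. Both edges thus lie inside one copy, where the finite check
  applies.\<close>

lemma necklace_noncrossing:
  assumes V: "p \<in> necklace_verts A" "q \<in> necklace_verts A" "r \<in> necklace_verts A" "s \<in> necklace_verts A"
    and adj: "necklace_adj p q" "necklace_adj r s"
    and page: "lower_page {p, q} = lower_page {r, s}"
    and ord: "spine p < spine r" "spine r < spine q" "spine q < spine s"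
  shows False
proof -
  obtain a i x where p: "p = (a, i, x)" by (metis prod_cases3)
  obtain a' j y where q: "q = (a', j, y)" by (metis prod_cases3)
  obtain b k z where r: "r = (b, k, z)" by (metis prod_cases3)
  obtain b' l w where s: "s = (b', l, w)" by (metis prod_cases3)
  have "a' = a" "b' = b" using adj by (auto simp: p q r s necklace_adj_def)
  note O = spine_less[OF V(1,3) ord(1)] spine_less[OF V(3,2) ord(2)] spine_less[OF V(2,4) ord(3)]
  have "b = a" using O by (auto simp: p q r s \<open>a' = a\<close> \<open>b' = b\<close>)
  have lt: "x < 12" "y < 12" "z < 12" "w < 12" "l < a"
    using V by (auto simp: p q r s necklace_verts_def \<open>a' = a\<close> \<open>b' = b\<close> \<open>b = a\<close>)
  have O': "i < k \<or> i = k \<and> x < z" "k < j \<or> k = j \<and> z < y" "j < l \<or> j = l \<and> y < w"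
    using O by (simp_all add: p q r s \<open>a' = a\<close> \<open>b' = b\<close> \<open>b = a\<close>)
  have A1: "i = j \<and> gadget x y \<or> x = 11 \<and> y = 0 \<and> cyc a i j \<or> x = 0 \<and> y = 11 \<and> cyc a j i"
    using adj(1) by (auto simp: p q necklace_adj_def \<open>a' = a\<close>)
  have A2: "k = l \<and> gadget z w \<or> z = 11 \<and> w = 0 \<and> cyc a k l \<or> z = 0 \<and> w = 11 \<and> cyc a l k"
    using adj(2) by (auto simp: r s necklace_adj_def \<open>b' = b\<close> \<open>b = a\<close>)
  have "i = j"
    using A1 O' lt by (auto simp: cyc_def)
  moreover have "k = l"
    using A2 O' lt \<open>i = j\<close> by (auto simp: cyc_def)
  ultimately have "i = k" "j = k" "l = k" using O' by auto
  then have o: "x < z" "z < y" "y < w" using O' by auto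
  have "gadget x y" using A1 o lt \<open>i = j\<close> by (auto simp: cyc_def)
  moreover have "gadget z w" using A2 o lt \<open>k = l\<close> by (auto simp: cyc_def)
  ultimately show False
    using gadget_noncrossing[of x y z w] o page lower_page_inner[of x y a i] lower_page_inner[of z w a i]
    by (simp add: p q r s \<open>a' = a\<close> \<open>b' = b\<close> \<open>b = a\<close> \<open>i = k\<close> \<open>j = k\<close> \<open>l = k\<close>)
qed

lemma planar_necklaces: "planar (necklaces A)"
\<comment> \<open>With \<open>page\<close> meaning the upper half plane, the chords called lower are
  drawn above the axis; the picture is merely reflected.\<close>
proof (rule planar_two_page[where pos = "\<lambda>v. real (spine v)" and page = lower_page])
  show "inj_on (\<lambda>v. real (spine v)) (verts (necklaces A))"
    using inj_on_spine by (auto simp: necklaces_def inj_on_def)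
  show "e \<subseteq> verts (necklaces A) \<and> card e = 2" if "e \<in> edges (necklaces A)" for e
  proof -
    obtain p q where "e = {p, q}" "p \<in> necklace_verts A" "q \<in> necklace_verts A" "necklace_adj p q"
      using \<open>e \<in> edges (necklaces A)\<close> by (auto simp: necklaces_def rel_graph_def)
    moreover from this have "p \<noteq> q" using irreflp_necklace_adj by (auto dest: irreflpD)
    ultimately show ?thesis by (simp add: necklaces_def)
  qed
  show False if "{p, q} \<in> edges (necklaces A)" "{r, s} \<in> edges (necklaces A)"
    "lower_page {p, q} = lower_page {r, s}"
    "real (spine p) < real (spine r)" "real (spine r) < real (spine q)" "real (spine q) < real (spine s)"
    for p q r s
    using that necklace_noncrossing[of p A q r s]
    by (simp add: necklaces_def edge_rel_graph_iff[OF symp_necklace_adj])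
qed

section \<open>Homomorphisms between rings\<close>

lemma gadget_ends:
  "gadget 0 y \<longleftrightarrow> y = 1 \<or> y = 4" "gadget 11 y \<longleftrightarrow> y = 10 \<or> y = 5"
  "\<not> gadget 1 4" "\<not> gadget 10 5" "\<not> gadget 4 1" "\<not> gadget 5 10"
  by (auto simp: gadget_def gadget_nbrs_def)

lemma cyc_unique: "cyc a i j \<Longrightarrow> cyc a i k \<Longrightarrow> j = k" "cyc a j i \<Longrightarrow> cyc a k i \<Longrightarrow> j = k"
  by (auto simp: cyc_def)

lemma cyc_neq: "2 \<le> a \<Longrightarrow> cyc a i j \<Longrightarrow> i \<noteq> j"
  by (auto simp: cyc_def)

text \<open>If the walk goes straight back over the link, its other three steps form a triangle at
  an end, whose neighbours are pairwise nonadjacent. Otherwise \<open>r\<close> and \<open>t\<close>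
  are inner vertices of different copies, and \<open>s\<close> would have to lie in both.\<close>

lemma link_not_in_pentagon:
  assumes "2 \<le> a" "cyc a i j"
    and adj: "necklace_adj (a, j, 0) r" "necklace_adj r s" "necklace_adj s t" "necklace_adj t (a, i, 11)"
  shows False
proof -
  have "i \<noteq> j" using cyc_neq assms by blast
  have inner: "\<exists>y. q = (a, k, y) \<and> gadget x y" if "necklace_adj (a, k, x) q" "x \<noteq> 0" "x \<noteq> 11" for k x q
    using that by (auto simp: necklace_adj_def split: prod.splits)
  have left: "q = (a, i, 10) \<or> q = (a, i, 5) \<or> q = (a, j, 0)" if "necklace_adj (a, i, 11) q" for q
    using that cyc_unique(1)[OF assms(2)] by (auto simp: necklace_adj_def gadget_ends split: prod.splits)
  have right: "q = (a, j, 1) \<or> q = (a, j, 4) \<or> q = (a, i, 11)" if "necklace_adj (a, j, 0) q" for q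
    using that cyc_unique(2)[OF assms(2)] by (auto simp: necklace_adj_def gadget_ends split: prod.splits)
  have t: "necklace_adj (a, i, 11) t" "necklace_adj t s"
    using adj(3,4) symp_necklace_adj by (auto dest: sympD)
  have r: "r = (a, j, 1) \<or> r = (a, j, 4) \<or> r = (a, i, 11)" using right adj(1) by blast
  have tt: "t = (a, i, 10) \<or> t = (a, i, 5) \<or> t = (a, j, 0)" using left t(1) by blast
  consider "r = (a, i, 11)" | "t = (a, j, 0)" | "r = (a, j, 1) \<or> r = (a, j, 4)" "t = (a, i, 10) \<or> t = (a, i, 5)"
    using r tt by blast
  then show False
  proof cases
    case 1
    then have "s = (a, i, 10) \<or> s = (a, i, 5) \<or> s = (a, j, 0)" using left adj(2) by blast
    then show False using tt adj(3) \<open>i \<noteq> j\<close>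
      by (auto simp: necklace_adj_def gadget_ends gadget_ends(3,5)[simplified] gadget_irrefl cyc_def)
  next
    case 2
    then have "s = (a, j, 1) \<or> s = (a, j, 4) \<or> s = (a, i, 11)" using right t(2) by blast
    then show False using r adj(2) \<open>i \<noteq> j\<close>
      by (auto simp: necklace_adj_def gadget_ends gadget_ends(3,5)[simplified] gadget_irrefl cyc_def)
  next
    case 3
    then show False using inner[of j _ s] inner[of i _ s] adj(2) t(2) \<open>i \<noteq> j\<close> by fastforce
  qed
qed

lemma pentagon_same_copy:
  assumes "2 \<le> fst p"
    and adj: "necklace_adj p q" "necklace_adj q r" "necklace_adj r s" "necklace_adj s t" "necklace_adj t p"
  shows "fst q = fst p \<and> fst (snd q) = fst (snd p)"
proof -
  obtain a i x where p: "p = (a, i, x)" by (metis prod_cases3)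
  obtain b j y where q: "q = (b, j, y)" by (metis prod_cases3)
  have sym: "necklace_adj v u" if "necklace_adj u v" for u v
    using that symp_necklace_adj by (auto dest: sympD)
  have "2 \<le> a" using assms(1) p by simp
  \<comment> \<open>The second instance traverses the pentagon backwards, for a link used in the
    opposite direction.\<close>
  then have "\<not> (x = 11 \<and> y = 0 \<and> b = a \<and> cyc a i j)" "\<not> (x = 0 \<and> y = 11 \<and> b = a \<and> cyc a j i)"
    using link_not_in_pentagon[of a i j r s t] link_not_in_pentagon[of a j i t s r] adj sym
    unfolding p q by blast+
  then show ?thesis using adj(1) by (auto simp: p q necklace_adj_def)
qed

text \<open>The pentagons 01234, 34567, 5-6-9-10-11 and 1-2-8-9-10 connect all vertices of a gadget.\<close>

lemma gadget_image:
  assumes B: "\<And>b. b \<in> B \<Longrightarrow> 2 \<le> b"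
    and V: "f ` necklace_verts A \<subseteq> necklace_verts B"
    and hom: "\<And>p q. p \<in> necklace_verts A \<Longrightarrow> q \<in> necklace_verts A \<Longrightarrow> necklace_adj p q \<Longrightarrow> necklace_adj (f p) (f q)"
    and ai: "a \<in> A" "i < a"
  shows "\<exists>b j. b \<in> B \<and> j < b \<and>
    (f (a, i, 0) = (b, j, 0) \<and> f (a, i, 11) = (b, j, 11) \<or>
     f (a, i, 0) = (b, j, 11) \<and> f (a, i, 11) = (b, j, 0))"
proof -
  define g where "g x = f (a, i, x)" for x
  have gV: "g x \<in> necklace_verts B" if "x < 12" for x
  proof -
    have "(a, i, x) \<in> necklace_verts A" using ai that by (simp add: necklace_verts_def)
    then show ?thesis using V unfolding g_def by blast
  qed
  then have g2: "2 \<le> fst (g x)" if "x < 12" for x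
    using B that by (fastforce simp: necklace_verts_def)
  have gadj: "necklace_adj (g x) (g y)" if "gadget x y" for x y
    unfolding g_def using that gadget_lt[OF that] ai
    by (intro hom) (auto simp: necklace_verts_def necklace_adj_def)
  \<comment> \<open>\<open>h x\<close> names the copy that contains the image of \<open>x\<close>;
    it is constant along each pentagon.\<close>
  define h where "h x = (fst (g x), fst (snd (g x)))" for x
  have step: "h y = h x" if "gadget x y" "gadget y u" "gadget u v" "gadget v w" "gadget w x" for x y u v w
    using pentagon_same_copy[OF g2 gadj gadj gadj gadj gadj, OF _ that] gadget_lt[OF that(1)]
    by (simp add: h_def)
  have cycle: "h x1 = h x0 \<and> h x2 = h x0 \<and> h x3 = h x0 \<and> h x4 = h x0"
    if "gadget x0 x1" "gadget x1 x2" "gadget x2 x3" "gadget x3 x4" "gadget x4 x0" for x0 x1 x2 x3 x4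
    using step[of x0 x1 x2 x3 x4] step[of x1 x2 x3 x4 x0] step[of x2 x3 x4 x0 x1] step[of x3 x4 x0 x1 x2] that
    by simp
  have "h 1 = h 0 \<and> h 2 = h 0 \<and> h 3 = h 0 \<and> h 4 = h 0"
    by (rule cycle) (simp_all add: gadget_def gadget_nbrs_def)
  moreover have "h 4 = h 3 \<and> h 5 = h 3 \<and> h 6 = h 3 \<and> h 7 = h 3"
    by (rule cycle) (simp_all add: gadget_def gadget_nbrs_def)
  moreover have "h 6 = h 5 \<and> h 9 = h 5 \<and> h 10 = h 5 \<and> h 11 = h 5"
    by (rule cycle) (simp_all add: gadget_def gadget_nbrs_def)
  moreover have "h 2 = h 1 \<and> h 8 = h 1 \<and> h 9 = h 1 \<and> h 10 = h 1"
    by (rule cycle) (simp_all add: gadget_def gadget_nbrs_def)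
  moreover have "x = 0 \<or> x = 1 \<or> x = 2 \<or> x = 3 \<or> x = 4 \<or> x = 5 \<or> x = 6 \<or> x = 7 \<or> x = 8 \<or> x = 9 \<or> x = 10 \<or> x = 11"
    if "x < 12" for x :: nat
    using that by presburger
  ultimately have h: "h x = h 0" if "x < 12" for x using that by metis
  define b j where "b = fst (g 0)" and "j = fst (snd (g 0))"
  have g: "g x = (b, j, snd (snd (g x)))" if "x < 12" for x
    using h[OF that] by (simp add: h_def b_def j_def prod_eq_iff)
  have bj: "b \<in> B" "j < b" using gV[of 0] g[of 0] by (auto simp: necklace_verts_def split: prod.splits)
  \<comment> \<open>All images lie in one copy, and by \<open>2 \<le> b\<close> no link joins a copy
    to itself, so the third coordinates form an endomorphism of the gadget.\<close>
  have "gadget (snd (snd (g x))) (snd (snd (g y)))" if "gadget x y" for x y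
  proof -
    have "necklace_adj (b, j, snd (snd (g x))) (b, j, snd (snd (g y)))"
      using gadj[OF that] g[of x] g[of y] gadget_lt[OF that] by simp
    then show ?thesis using cyc_neq[of b j j] B[OF bj(1)] by (auto simp: necklace_adj_def)
  qed
  from gadget_rigid[of "\<lambda>x. snd (snd (g x))", OF this] show ?thesis
    using g[of 0] g[of 11] bj unfolding g_def by fastforce
qed

lemma cyc_dvd: "cyc b j k \<Longrightarrow> int b dvd int k - int j - 1"
proof -
  assume "cyc b j k"
  then have "int k - int j - 1 = 0 \<or> int k - int j - 1 = - int b" by (auto simp: cyc_def)
  then show ?thesis by (metis dvd_0_right dvd_minus_iff dvd_refl)
qed

text \<open>A winding argument: copies go to copies and links to links, all in the same direction,
  so each link changes the index of the image by \<open>s\<close> modulo \<open>b\<close>. After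
  \<open>a\<close> links the walk is closed, hence \<open>b dvd a\<close>.\<close>

lemma hom_between_necklaces_dvd:
  assumes A: "\<And>a. a \<in> A \<Longrightarrow> 2 \<le> a" and B: "\<And>b. b \<in> B \<Longrightarrow> 2 \<le> b"
    and "necklaces A \<le>\<^sub>h necklaces B" and a: "a \<in> A"
  shows "\<exists>b\<in>B. b dvd a"
proof -
  obtain f where f: "graph_hom f (necklaces A) (necklaces B)"
    using assms(3) unfolding hom_le_def by blast
  then have V: "f ` necklace_verts A \<subseteq> necklace_verts B"
    and hom: "\<And>p q. p \<in> necklace_verts A \<Longrightarrow> q \<in> necklace_verts A \<Longrightarrow> necklace_adj p q \<Longrightarrow> necklace_adj (f p) (f q)"
    unfolding necklaces_def graph_hom_rel_graph[OF symp_necklace_adj] by auto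
  have image: "\<exists>b j. b \<in> B \<and> j < b \<and>
      (f (a, i, 0) = (b, j, 0) \<and> f (a, i, 11) = (b, j, 11) \<or>
       f (a, i, 0) = (b, j, 11) \<and> f (a, i, 11) = (b, j, 0))" if "i < a" for i
    by (rule gadget_image[where A = A and B = B]; (rule B V a that | erule (2) hom)?)
  have "2 \<le> a" using A a .
  \<comment> \<open>The ring is traversed in the direction \<open>s\<close>, with each gadget reversed if \<open>s = -1\<close>.\<close>
  obtain b j0 e e' :: nat and s :: int where b: "b \<in> B" "j0 < b"
    and f0: "f (a, 0, 0) = (b, j0, e')" "f (a, 0, 11) = (b, j0, e)"
    and e: "e = 11 \<and> e' = 0 \<and> s = 1 \<or> e = 0 \<and> e' = 11 \<and> s = - 1"
  proof -
    obtain b j where "b \<in> B" "j < b" "f (a, 0, 0) = (b, j, 0) \<and> f (a, 0, 11) = (b, j, 11) \<or>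
        f (a, 0, 0) = (b, j, 11) \<and> f (a, 0, 11) = (b, j, 0)"
      using image[of 0] \<open>2 \<le> a\<close> by auto
    then show ?thesis using that[of b j 0 11 1] that[of b j 11 0 "- 1"] by blast
  qed
  \<comment> \<open>The image of a link joins two gadget ends. The ends of a gadget are not
    adjacent, so this is again a link; it leaves at \<open>e\<close> and must enter the next copy at
    \<open>e'\<close>, which preserves the direction.\<close>
  have link: "\<exists>j'. f (a, i', 0) = (b, j', e') \<and> f (a, i', 11) = (b, j', e) \<and> int b dvd int j' - int j - s"
    if "cyc a i i'" "f (a, i, 11) = (b, j, e)" for i i' j
  proof -
    have i: "i < a" "i' < a" using that(1) by (auto simp: cyc_def)
    obtain c k where ck: "f (a, i', 0) = (c, k, 0) \<and> f (a, i', 11) = (c, k, 11) \<or>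
        f (a, i', 0) = (c, k, 11) \<and> f (a, i', 11) = (c, k, 0)"
      using image[OF i(2)] by blast
    have "necklace_adj (f (a, i, 11)) (f (a, i', 0))"
      using that(1) i a by (intro hom) (auto simp: necklace_verts_def necklace_adj_def)
    then have "f (a, i', 0) = (b, k, e') \<and> f (a, i', 11) = (b, k, e) \<and>
        (s = 1 \<and> cyc b j k \<or> s = - 1 \<and> cyc b k j)"
      using ck e that(2) by (auto simp: necklace_adj_def gadget_ends)
    moreover from this have "int b dvd int k - int j - s"
      using cyc_dvd[of b j k] cyc_dvd[of b k j] dvd_minus_iff[of "int b" "int j - int k - 1"]
      by (auto simp: algebra_simps)
    ultimately show ?thesis by blast
  qed
  have "\<exists>j. f (a, i, 0) = (b, j, e') \<and> f (a, i, 11) = (b, j, e) \<and> int b dvd int j - int j0 - s * int i"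
    if "i < a" for i
    using that
  proof (induction i)
    case 0
    then show ?case using f0 by simp
  next
    case (Suc i)
    then obtain j where j: "f (a, i, 11) = (b, j, e)" "int b dvd int j - int j0 - s * int i" by auto
    obtain j' where j': "f (a, Suc i, 0) = (b, j', e')" "f (a, Suc i, 11) = (b, j', e)"
      "int b dvd int j' - int j - s"
      using link[OF _ j(1), of "Suc i"] Suc.prems by (auto simp: cyc_def)
    have "int j' - int j0 - s * int (Suc i) = (int j - int j0 - s * int i) + (int j' - int j - s)"
      by (simp add: algebra_simps)
    then have "int b dvd int j' - int j0 - s * int (Suc i)" using j(2) j'(3) by (metis dvd_add)
    then show ?case using j' by blast
  qed
  from this[of "a - 1"] obtain j where j: "f (a, a - 1, 11) = (b, j, e)"
    "int b dvd int j - int j0 - s * int (a - 1)"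
    using \<open>2 \<le> a\<close> by auto
  \<comment> \<open>The closing link returns to index \<open>j0\<close>; in the sum of the
    congruences everything but \<open>s * int a\<close> cancels.\<close>
  have "cyc a (a - 1) 0" using \<open>2 \<le> a\<close> by (simp add: cyc_def)
  then have "int b dvd int j0 - int j - s" using link[OF _ j(1), of 0] f0 by auto
  then have "int b dvd (int j - int j0 - s * int (a - 1)) + (int j0 - int j - s)" using j(2) by (rule dvd_add[rotated])
  also have "\<dots> = - (s * int a)" using \<open>2 \<le> a\<close> by (simp add: of_nat_diff algebra_simps)
  finally have "int b dvd int a" using e by auto
  then show ?thesis using b by auto
qed

text \<open>The step from \<open>a - 1\<close> to 0 remains a successor step modulo \<open>b\<close>
  because \<open>b\<close> divides \<open>a\<close>.\<close>

lemma cyc_mod: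
  assumes "b dvd a" "0 < b" "cyc a i j"
  shows "cyc b (i mod b) (j mod b)"
proof -
  have "j mod b = Suc i mod b" using assms by (auto simp: cyc_def mod_eq_0_iff_dvd)
  then show ?thesis using assms(2) by (auto simp: cyc_def mod_Suc intro!: Suc_lessI)
qed

text \<open>For the converse, each ring is wound around a ring of a dividing length by reducing the
  copy index and keeping the gadget vertex.\<close>

lemma necklaces_hom_le_iff:
  assumes A: "\<And>a. a \<in> A \<Longrightarrow> 2 \<le> a" and B: "\<And>b. b \<in> B \<Longrightarrow> 2 \<le> b"
  shows "necklaces A \<le>\<^sub>h necklaces B \<longleftrightarrow> (\<forall>a\<in>A. \<exists>b\<in>B. b dvd a)"
proof
  assume "\<forall>a\<in>A. \<exists>b\<in>B. b dvd a"
  then obtain \<beta> where \<beta>: "\<And>a. a \<in> A \<Longrightarrow> \<beta> a \<in> B \<and> \<beta> a dvd a" by metis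
  define f where "f = (\<lambda>(a, i, x :: nat). (\<beta> a, i mod \<beta> a, x))"
  have pos: "0 < \<beta> a" if "a \<in> A" for a using \<beta>[OF that] B by fastforce
  have "graph_hom f (necklaces A) (necklaces B)"
    unfolding necklaces_def graph_hom_rel_graph[OF symp_necklace_adj]
  proof (intro conjI ballI impI)
    show "f ` necklace_verts A \<subseteq> necklace_verts B"
      using \<beta> pos by (auto simp: f_def necklace_verts_def)
    show "necklace_adj (f p) (f q)" if "p \<in> necklace_verts A" "q \<in> necklace_verts A" "necklace_adj p q" for p q
    proof -
      obtain a i x where p: "p = (a, i, x)" by (metis prod_cases3)
      obtain b j y where q: "q = (b, j, y)" by (metis prod_cases3)
      have a: "a \<in> A" using that(1) by (simp add: p necklace_verts_def)
      have "cyc (\<beta> a) (k mod \<beta> a) (l mod \<beta> a)" if "cyc a k l" for k l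
        by (rule cyc_mod[OF conjunct2[OF \<beta>[OF a]] pos[OF a] that])
      then show ?thesis using that(3) by (auto simp: p q f_def necklace_adj_def)
    qed
  qed
  then show "necklaces A \<le>\<^sub>h necklaces B" unfolding hom_le_def by blast
next
  assume "necklaces A \<le>\<^sub>h necklaces B"
  then show "\<forall>a\<in>A. \<exists>b\<in>B. b dvd a"
    using hom_between_necklaces_dvd[of A B] A B by simp
qed

section \<open>Universality\<close>

text \<open>Finite sets under inclusion are encoded as squarefree numbers under
  divisibility.\<close>

lemma prod_primes_dvd_iff:
  fixes p :: "'a \<Rightarrow> nat"
  assumes "inj p" "\<And>z. prime (p z)" "finite S" "finite T"
  shows "prod p S dvd prod p T \<longleftrightarrow> S \<subseteq> T"
proof
  assume dvd: "prod p S dvd prod p T"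
  show "S \<subseteq> T"
  proof
    fix z assume "z \<in> S"
    then have "p z dvd prod p T" using dvd assms(3) by (meson dvd_prodI dvd_trans)
    then obtain t where "t \<in> T" "p z dvd p t"
      using prime_dvd_prod_iff[OF assms(4,2)] by blast
    then show "z \<in> T" using primes_dvd_imp_eq[OF assms(2,2)] assms(1) by (metis injD)
  qed
qed (use assms(4) in \<open>rule prod_dvd_prod_subset\<close>)

text \<open>The code of \<open>y\<close> is the product of the primes with indices \<open>z \<le> y\<close> above \<open>y\<close>, so that
  \<open>code y' dvd code y\<close> iff \<open>y' \<le> y\<close> and \<open>(y, y') \<in> r\<close>. Then \<open>E x\<close> holds the codes of the \<open>y \<le> x\<close>
  below \<open>x\<close>: if \<open>u\<close> is one of them and \<open>(x, y) \<in> r\<close>, then \<open>code u\<close> is in \<open>E y\<close> or is divisible by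
  \<open>code y\<close>, according to whether \<open>u \<le> y\<close> or \<open>y \<le> u\<close>.\<close>

lemma countable_order_coded_by_divisibility:
  fixes A :: "nat set"
  assumes "partial_order_on A r"
  shows "\<exists>E :: nat \<Rightarrow> nat set.
    (\<forall>x\<in>A. finite (E x) \<and> E x \<noteq> {} \<and> (\<forall>a\<in>E x. 2 \<le> a)) \<and>
    (\<forall>x\<in>A. \<forall>y\<in>A. (x, y) \<in> r \<longleftrightarrow> (\<forall>a\<in>E x. \<exists>b\<in>E y. b dvd a))"
proof -
  have refl: "(x, x) \<in> r" if "x \<in> A" for x
    using assms that by (auto simp: partial_order_on_def preorder_on_def refl_on_def)
  have trans: "(x, z) \<in> r" if "(x, y) \<in> r" "(y, z) \<in> r" for x y z
    using assms that by (auto simp: partial_order_on_def preorder_on_def dest: transD)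
  define p where "p = enumerate {q :: nat. prime q}"
  have inj: "inj p"
    unfolding p_def using strict_mono_enumerate[OF primes_infinite] by (rule strict_mono_imp_inj_on)
  have prime: "prime (p z)" for z
    unfolding p_def using enumerate_in_set[OF primes_infinite, of z] by simp
  \<comment> \<open>Cutting off at \<open>y\<close> in the usual order of the naturals keeps these
    sets finite, although up-sets and down-sets of \<open>r\<close> may be infinite.\<close>
  define up where "up y = {z \<in> A. z \<le> y \<and> (y, z) \<in> r}" for y
  define down where "down x = {y \<in> A. y \<le> x \<and> (y, x) \<in> r}" for x
  define code where "code y = prod p (up y)" for y
  have fin: "finite (up y)" "finite (down y)" for y
    unfolding up_def down_def by (rule finite_subset[of _ "{..y}"]; auto)+
  have code_dvd: "code y' dvd code y \<longleftrightarrow> y' \<le> y \<and> (y, y') \<in> r" if "y \<in> A" "y' \<in> A" for y y'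
  proof -
    have "code y' dvd code y \<longleftrightarrow> up y' \<subseteq> up y"
      unfolding code_def using prod_primes_dvd_iff[OF inj prime fin(1) fin(1)] .
    also have "\<dots> \<longleftrightarrow> y' \<le> y \<and> (y, y') \<in> r"
    proof
      assume "up y' \<subseteq> up y"
      moreover have "y' \<in> up y'" using refl[OF that(2)] that(2) by (simp add: up_def)
      ultimately have "y' \<in> up y" by blast
      then show "y' \<le> y \<and> (y, y') \<in> r" by (simp add: up_def)
    next
      assume y: "y' \<le> y \<and> (y, y') \<in> r"
      show "up y' \<subseteq> up y"
      proof
        fix z assume "z \<in> up y'"
        then show "z \<in> up y" using y trans[of y y' z] by (simp add: up_def)
      qed
    qed
    finally show ?thesis .
  qed
  have code_ge: "2 \<le> code y" if "y \<in> A" for y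
  proof -
    have "p y dvd code y"
      unfolding code_def using that refl fin(1) by (intro dvd_prodI) (auto simp: up_def)
    moreover have "code y \<noteq> 0" unfolding code_def using prime_gt_0_nat[OF prime] fin(1) by (auto simp: prod_zero_iff)
    ultimately show ?thesis using prime_ge_2_nat[OF prime, of y] dvd_imp_le[of "p y" "code y"] by simp
  qed
  have iff: "(x, y) \<in> r \<longleftrightarrow> (\<forall>a\<in>code ` down x. \<exists>b\<in>code ` down y. b dvd a)" if xy: "x \<in> A" "y \<in> A" for x y
  proof
    assume r: "(x, y) \<in> r"
    show "\<forall>a\<in>code ` down x. \<exists>b\<in>code ` down y. b dvd a"
    proof
      fix a assume "a \<in> code ` down x"
      then obtain u where u: "u \<in> A" "u \<le> x" "(u, x) \<in> r" "a = code u" by (auto simp: down_def)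
      then have uy: "(u, y) \<in> r" using r trans by blast
      have "code y dvd a \<and> y \<in> down y \<or> u \<in> down y"
        using u uy xy refl code_dvd[of u y] by (auto simp: down_def)
      then show "\<exists>b\<in>code ` down y. b dvd a"
        using u(4) dvd_refl[of a] by (elim disjE conjE) (blast intro: bexI)+
    qed
  next
    assume dvd: "\<forall>a\<in>code ` down x. \<exists>b\<in>code ` down y. b dvd a"
    \<comment> \<open>The code of \<open>x\<close> itself is a sufficient test: a divisor
      \<open>code u\<close> gives \<open>(x, u) \<in> r\<close>, and \<open>u \<in> down y\<close>
      gives \<open>(u, y) \<in> r\<close>.\<close>
    have "x \<in> down x" using xy refl by (simp add: down_def)
    then obtain u where "u \<in> down y" "code u dvd code x" using dvd by blast
    then show "(x, y) \<in> r" using code_dvd[of x u] xy trans by (auto simp: down_def)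
  qed
  show ?thesis
  proof (intro exI[of _ "\<lambda>x. code ` down x"] conjI)
    show "\<forall>x\<in>A. finite (code ` down x) \<and> code ` down x \<noteq> {} \<and> (\<forall>a\<in>code ` down x. 2 \<le> a)"
      using refl fin(2) code_ge by (auto simp: down_def)
  qed (use iff in simp)
qed

text \<open>One graph is chosen from each class of homomorphic equivalence. Equivalent graphs
  present the same predicate to the choice operator, so they get the same representative, which
  yields antisymmetry.\<close>

lemma hom_order_representatives:
  obtains S where "S \<subseteq> K" "partial_order_on S (hom_order S)"
    "\<And>G. G \<in> K \<Longrightarrow> \<exists>H\<in>S. G \<le>\<^sub>h H \<and> H \<le>\<^sub>h G"
proof -
  define rep where "rep G = (SOME H. H \<in> K \<and> G \<le>\<^sub>h H \<and> H \<le>\<^sub>h G)" for G :: "nat graph"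
  have rep: "rep G \<in> K \<and> G \<le>\<^sub>h rep G \<and> rep G \<le>\<^sub>h G" if "G \<in> K" for G
    unfolding rep_def by (rule someI[of _ G]) (use that hom_le_refl in blast)
  have rep_eq: "rep G = rep H" if "G \<le>\<^sub>h H" "H \<le>\<^sub>h G" for G H
  proof -
    have "G \<le>\<^sub>h L \<and> L \<le>\<^sub>h G \<longleftrightarrow> H \<le>\<^sub>h L \<and> L \<le>\<^sub>h H" for L
      using hom_le_trans[OF that(1), of L] hom_le_trans[OF that(2), of L]
        hom_le_trans[OF _ that(1), of L] hom_le_trans[OF _ that(2), of L] by blast
    then show ?thesis unfolding rep_def by (intro arg_cong[where f = Eps] ext) blast
  qed
  have "antisym (hom_order (rep ` K))"
  proof (rule antisymI)
    fix G' H' assume "(G', H') \<in> hom_order (rep ` K)" "(H', G') \<in> hom_order (rep ` K)"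
    then obtain G H where GH: "G \<in> K" "H \<in> K" "G' = rep G" "H' = rep H" "rep G \<le>\<^sub>h rep H" "rep H \<le>\<^sub>h rep G"
      unfolding hom_order_def by auto
    have "G \<le>\<^sub>h H" by (meson GH rep hom_le_trans)
    moreover have "H \<le>\<^sub>h G" by (meson GH rep hom_le_trans)
    ultimately have "rep G = rep H" by (rule rep_eq)
    then show "G' = H'" using GH(3,4) by simp
  qed
  then have "partial_order_on (rep ` K) (hom_order (rep ` K))"
    using preorder_on_hom_order by (simp add: partial_order_on_def)
  then show ?thesis using rep by (intro that[of "rep ` K"]) blast+
qed

theorem theorem7p13:
  shows "\<exists>S \<subseteq> cubic_planar_graphs. universal_partial_order S (hom_order S)"
proof -
  define N :: "nat set \<Rightarrow> nat graph" where "N A = image_graph to_nat (necklaces A)" for A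
  have N: "N A \<in> cubic_planar_graphs" if "finite A \<and> A \<noteq> {} \<and> (\<forall>a\<in>A. 2 \<le> a)" for A
    using that finite_simple_necklaces cubic_necklaces planar_necklaces
    unfolding N_def cubic_planar_graphs_def
    by (simp add: finite_simple_image_graph cubic_image_graph planar_image_graph)
  obtain S where S: "S \<subseteq> cubic_planar_graphs" "partial_order_on S (hom_order S)"
    "\<And>G. G \<in> cubic_planar_graphs \<Longrightarrow> \<exists>H\<in>S. G \<le>\<^sub>h H \<and> H \<le>\<^sub>h G"
    using hom_order_representatives[of cubic_planar_graphs] by blast
  have "\<exists>f. order_embedding f A r S (hom_order S)" if po: "partial_order_on A r" for A :: "nat set" and r
  proof -
    obtain E :: "nat \<Rightarrow> nat set"
      where E1: "\<forall>x\<in>A. finite (E x) \<and> E x \<noteq> {} \<and> (\<forall>a\<in>E x. 2 \<le> a)"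
        and E2: "\<forall>x\<in>A. \<forall>y\<in>A. (x, y) \<in> r \<longleftrightarrow> (\<forall>a\<in>E x. \<exists>b\<in>E y. b dvd a)"
      using countable_order_coded_by_divisibility[OF po] by (elim exE conjE)
    have "\<forall>x\<in>A. \<exists>H\<in>S. N (E x) \<le>\<^sub>h H \<and> H \<le>\<^sub>h N (E x)" using S(3) N E1 by simp
    then obtain f where f: "\<And>x. x \<in> A \<Longrightarrow> f x \<in> S \<and> N (E x) \<le>\<^sub>h f x \<and> f x \<le>\<^sub>h N (E x)"
      by metis
    have iff: "(x, y) \<in> r \<longleftrightarrow> (f x, f y) \<in> hom_order S" if "x \<in> A" "y \<in> A" for x y
    proof -
      have "f x \<le>\<^sub>h f y \<longleftrightarrow> N (E x) \<le>\<^sub>h N (E y)"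
        using f[OF that(1)] f[OF that(2)] by (meson hom_le_trans)
      also have "\<dots> \<longleftrightarrow> necklaces (E x) \<le>\<^sub>h necklaces (E y)"
        unfolding N_def by (rule hom_le_image_graph_iff) simp_all
      also have "\<dots> \<longleftrightarrow> (x, y) \<in> r"
        using E1 E2 that by (subst necklaces_hom_le_iff) simp_all
      finally show ?thesis using f that by (simp add: hom_order_def)
    qed
    \<comment> \<open>A map that reflects the order is injective because \<open>r\<close> is
      antisymmetric.\<close>
    have "inj_on f A"
    proof (rule inj_onI)
      fix x y assume xy: "x \<in> A" "y \<in> A" "f x = f y"
      have "(f x, f y) \<in> hom_order S" "(f y, f x) \<in> hom_order S"
        using xy f hom_le_refl by (simp_all add: hom_order_def)
      then show "x = y" using iff xy po by (metis antisymD partial_order_onD(3))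
    qed
    then have "order_embedding f A r S (hom_order S)"
      using f iff by (auto simp: order_embedding_def)
    then show ?thesis by blast
  qed
  then have "universal_partial_order S (hom_order S)"
    using S(2) by (simp add: universal_partial_order_def)
  then show ?thesis using S(1) by blast
qed

end
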